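(* Let $f_1,f_2\in\mathbb{D}$, $f_1f_2\neq0$, and set $\Phi_2(z)=(z-f_1)(z-f_2)$. The system $$\frac{\Phi_2(z)}{\Phi_2^*(z)}=w f_1,\qquad \frac{\Phi_2(w)}{\Phi_2^*(w)}=z f_2$$ has exactly $5$ distinct solution pairs $(z,w)\in\mathbb{C}^2$: four of them are in $\mathbb{D}^2$, namely $(0,f_2)$, $(f_1,0)$, $(z_1,w_1)$, $(z_2,w_2)$, and exactly one solution $(z_3,w_3)$ satisfies $|z_3|>1$, $|w_3|>1$. Moreover, the points $z_1,z_2,z_3$ are collinear, as are $w_1,w_2,w_3$. More precisely: (i) It holds that $$\frac{z_1-f_2}{w_1-f_1}=\frac{z_2-f_2}{w_2-f_1}=\frac{z_3-f_2}{w_3-f_1}=\frac{f_1\,\Phi_2^*(f_2)}{f_2\,\Phi_2^*(f_1)}.$$ (ii) The points $f_1,w_1,w_2,w_3$ are collinear, i.e. $$\frac{w_i-f_1}{w_j-f_1}\in\mathbb{R},\qquad i,j\in\{1,2,3\},\ i\neq j,$$ and the points $f_2,z_1,z_2,z_3$ are collinear, i.e. $$\frac{z_i-f_2}{z_j-f_2}\in\mathbb{R},\qquad i,j\in\{1,2,3\},\ i\neq j.$$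
   Context: $\mathbb{D}$ is the open unit disk in $\mathbb{C}$. $\Phi_2^*$ is the reversed polynomial of $\Phi_2$: $\Phi_2^*(z)=z^2\,\overline{\Phi_2(1/\bar z)}=(1-\bar f_1z)(1-\bar f_2z)$.
   Formalization: "Exactly 5 distinct" fails for some parameters (e.g. f_2=1/2, f_1=(3+√73)/16, where (0,f_2) is double); proved instead: the five listed solutions, with multiplicity, are all, and they are 5 distinct pairs iff (0,f_2) and (f_1,0) are simple. *)

theory Defs
  imports "HOL-Complex_Analysis.Complex_Analysis" "HOL-Library.Multiset"
begin

definition Phi2 :: "complex \<Rightarrow> complex \<Rightarrow> complex \<Rightarrow> complex" where
  "Phi2 f1 f2 z = (z - f1) * (z - f2)"

definition Phi2_star :: "complex \<Rightarrow> complex \<Rightarrow> complex \<Rightarrow> complex" where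
  "Phi2_star f1 f2 z = (1 - cnj f1 * z) * (1 - cnj f2 * z)"

text \<open>The reversal formula needs \<open>z \<noteq> 0\<close>: at the origin it evaluates to 0 in HOL,
  whereas the reversed polynomial has constant term 1.\<close>

lemma Phi2_star_reversed:
  assumes "z \<noteq> 0"
  shows "Phi2_star f1 f2 z = z ^ 2 * cnj (Phi2 f1 f2 (1 / cnj z))"
  using assms by (simp add: Phi2_def Phi2_star_def power2_eq_square field_simps)

text \<open>The conditions \<open>Phi2_star \<noteq> 0\<close> say that the two quotients are defined; without
  them \<open>x / 0 = 0\<close> would give the equations a meaning at the poles.\<close>

definition solutions :: "complex \<Rightarrow> complex \<Rightarrow> (complex \<times> complex) set" where
  "solutions f1 f2 = {(z, w).
     Phi2_star f1 f2 z \<noteq> 0 \<and> Phi2_star f1 f2 w \<noteq> 0 \<and>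
     Phi2 f1 f2 z / Phi2_star f1 f2 z = w * f1 \<and>
     Phi2 f1 f2 w / Phi2_star f1 f2 w = z * f2}"

text \<open>Multiplicity of a solution. The first equation is the graph \<open>w = g z\<close> with
  \<open>g t = Phi2 t / (f1 * Phi2_star t)\<close>, so the intersection multiplicity of the two
  curves at \<open>(z, w)\<close> is the order of vanishing at \<open>z\<close> of the second equation
  restricted to that graph. It is needed because for exceptional parameters, e.g.
  \<open>f1 = (3 + sqrt 73) / 16\<close> and \<open>f2 = 1 / 2\<close>, the solution \<open>(0, f2)\<close> is a double one and
  there are only four distinct solutions.\<close>

definition solution_mult :: "complex \<Rightarrow> complex \<Rightarrow> complex \<times> complex \<Rightarrow> int" where
  "solution_mult f1 f2 p =
     zorder (\<lambda>t. let u = Phi2 f1 f2 t / (f1 * Phi2_star f1 f2 t)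
                 in Phi2 f1 f2 u / Phi2_star f1 f2 u - t * f2) (fst p)"

end

theory Submission
  imports Defs
begin

text \<open>
  Write \<open>a = f1\<close>, \<open>b = f2\<close>, \<open>p = \<bar>a\<bar>\<^sup>2\<close>, \<open>q = \<bar>b\<bar>\<^sup>2\<close> and \<open>N = \<bar>1 - cnj a * b\<bar>\<^sup>2\<close>. Two solutions,
  \<open>(0, b)\<close> and \<open>(a, 0)\<close>, are visible. The key observation is that the others lie on one line through \<open>(b, a)\<close>,
  which can be parametrized as
  \<open>z = b + a * (1 - cnj a * b) * (1 - q) * t\<close>, \<open>w = a + b * (1 - cnj b * a) * (1 - p) * t\<close>
  (\<open>line_point\<close>). On this line, after clearing denominators, \<^emph>\<open>both\<close> equations reduce to the
  same cubic equation in \<open>t\<close>, and this cubic has real coefficients: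
  \<open>(1 + N t) (1 - p (1 - q) t) (1 - q (1 - p) t) = (1 - p) (1 - q) t\<^sup>2\<close>
  (\<open>line_cubic\<close>, \<open>first_equation_on_line\<close>).

  Its shape makes the roots easy to locate: the cubic is negative at the three zeros of the
  product on the left and positive at \<open>0\<close>, at \<open>1 / (1 - p q)\<close> and for large \<open>t\<close>, so it has three distinct
  real roots, none of them \<open>0\<close> (\<open>line_cubic_roots\<close>). Real parameters give collinearity and
  the constant quotient \<open>(z - f2) / (w - f1)\<close>. On which side of the unit circle a root lies
  is read off from
  \<open>1 - \<bar>z\<bar>\<^sup>2 = (1 - q) * ((1 + N t) (1 - p (1 - q) t) - (1 - p) t)\<close>
  (\<open>disc_factor\<close>, \<open>one_minus_norm_sq_line_point\<close>) and the same formula for \<open>w\<close> with \<open>p\<close> and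
  \<open>q\<close> exchanged.

  That there are no further solutions, and the multiplicities, come from eliminating \<open>w\<close>. This
  leaves a quintic in \<open>z\<close>, which equals a nonzero constant times \<open>z (z - a)\<close> times the cubic
  (\<open>eliminant_on_line\<close>). Near a solution the function that defines the multiplicity is this
  quintic divided by a nonvanishing function (\<open>second_equation_on_graph\<close>), so its order of
  vanishing is the number of times the point occurs among the five roots
  (\<open>solution_mult_eq_count\<close>).
\<close>

section \<open>A real cubic with three real roots\<close>

definition line_cubic :: "'a::comm_ring_1 \<Rightarrow> 'a \<Rightarrow> 'a \<Rightarrow> 'a \<Rightarrow> 'a" where
  "line_cubic p q N t =
     (1 + N * t) * (1 - p * (1 - q) * t) * (1 - q * (1 - p) * t) - (1 - p) * (1 - q) * t\<^sup>2"

text \<open>Up to a positive constant, the value of \<open>1 - \<bar>z\<bar>\<^sup>2\<close> at the point of the line with parameter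
  \<open>t\<close>, see \<open>one_minus_norm_sq_line_point\<close> below.\<close>

definition disc_factor :: "'a::comm_ring_1 \<Rightarrow> 'a \<Rightarrow> 'a \<Rightarrow> 'a \<Rightarrow> 'a" where
  "disc_factor p q N t = (1 + N * t) * (1 - p * (1 - q) * t) - (1 - p) * t"

lemma line_cubic_commute: "line_cubic p q N t = line_cubic q p N t"
  by (simp add: line_cubic_def algebra_simps)

lemma line_cubic_of_real:
  "line_cubic (of_real p) (of_real q) (of_real N) (of_real t :: complex) = of_real (line_cubic p q N t)"
  by (simp add: line_cubic_def)

lemma disc_factor_of_real:
  "disc_factor (of_real p) (of_real q) (of_real N) (of_real t :: complex) = of_real (disc_factor p q N t)"
  by (simp add: disc_factor_def)

lemma continuous_on_line_cubic: "continuous_on S (line_cubic (p :: real) q N)"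
  unfolding line_cubic_def [abs_def] by (intro continuous_intros)

lemma mult_less_one:
  fixes p q :: real
  assumes "0 < p" "p < 1" "0 < q" "q < 1"
  shows "p * q < 1"
  using mult_strict_mono[of p 1 q 1] assms by simp

lemma line_cubic_neg_at_zero_of_product:
  fixes p q N t :: real
  assumes "p < 1" "q < 1"
    and "t \<noteq> 0" and "p * (1 - q) * t = 1 \<or> q * (1 - p) * t = 1 \<or> N * t = -1"
  shows "line_cubic p q N t < 0"
proof -
  have "(1 + N * t) * (1 - p * (1 - q) * t) * (1 - q * (1 - p) * t) = 0"
    using assms(4) by auto
  moreover have "(1 - p) * (1 - q) * t\<^sup>2 > 0"
    using assms by simp
  ultimately show ?thesis unfolding line_cubic_def by linarith
qed

text \<open>At this parameter the two decreasing factors become \<open>(1 - p) s\<close> and \<open>(1 - q) s\<close>, so that the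
  subtracted square cancels all but the contribution of \<open>N\<close>. The point is also the threshold for
  \<open>disc_factor\<close> in \<open>disc_factor_pos_middle_root\<close>; the middle root is sought beyond it
  for that reason.\<close>

lemma line_cubic_pos_middle:
  fixes p q N :: real
  assumes "0 < p" "p < 1" "0 < q" "q < 1" "0 < N"
  shows "line_cubic p q N (1 / (1 - p * q)) > 0"
proof -
  define s where "s = 1 / (1 - p * q)"
  have d: "1 - p * q > 0" using mult_less_one assms by simp
  then have s: "s > 0" by (simp add: s_def)
  have 1: "1 - p * (1 - q) * s = (1 - p) * s" "1 - q * (1 - p) * s = (1 - q) * s"
    using d by (simp_all add: s_def field_simps)
  have "line_cubic p q N s = N * s * ((1 - p) * s * ((1 - q) * s))"
    unfolding line_cubic_def 1 by (simp add: algebra_simps power2_eq_square)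
  also have "\<dots> > 0" using assms s by simp
  finally show ?thesis by (simp add: s_def)
qed

text \<open>The leading coefficient is positive. The explicit bound makes \<open>\<alpha> T - 1\<close> and \<open>\<beta> T - 1\<close> at
  least half of \<open>\<alpha> T\<close> and \<open>\<beta> T\<close>, after which the cubic term beats the quadratic one.\<close>

lemma line_cubic_pos_far:
  fixes p q N :: real
  assumes "0 < p" "p < 1" "0 < q" "q < 1" "0 < N"
  shows "\<exists>T \<ge> t0. line_cubic p q N T > 0"
proof -
  define \<alpha> where "\<alpha> = p * (1 - q)"
  define \<beta> where "\<beta> = q * (1 - p)"
  have pos: "\<alpha> > 0" "\<beta> > 0" using assms by (simp_all add: \<alpha>_def \<beta>_def)
  define T where "T = max t0 (2 / \<alpha> + 2 / \<beta> + 4 / (N * (p * q)))"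
  have T: "T \<ge> 2 / \<alpha> + 2 / \<beta> + 4 / (N * (p * q))" "T \<ge> t0" by (simp_all add: T_def)
  have parts: "2 / \<alpha> > 0" "2 / \<beta> > 0" "4 / (N * (p * q)) > 0" using pos assms by simp_all
  have "T > 0" using T parts by linarith
  have "T \<ge> 2 / \<alpha>" "T \<ge> 2 / \<beta>" "T > 4 / (N * (p * q))" using T parts by linarith+
  then have b: "2 \<le> \<alpha> * T" "2 \<le> \<beta> * T" "4 < N * (p * q) * T"
    using pos assms by (simp_all add: field_simps)
  have "(\<alpha> * T / 2) * (\<beta> * T / 2) \<le> (\<alpha> * T - 1) * (\<beta> * T - 1)"
    by (intro mult_mono) (use b in linarith)+
  then have "(1 + N * T) * ((\<alpha> * T / 2) * (\<beta> * T / 2)) \<le> (1 + N * T) * ((\<alpha> * T - 1) * (\<beta> * T - 1))"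
    using \<open>T > 0\<close> assms by (intro mult_left_mono) auto
  moreover have "(N * T) * ((\<alpha> * T / 2) * (\<beta> * T / 2)) \<le> (1 + N * T) * ((\<alpha> * T / 2) * (\<beta> * T / 2))"
    using pos \<open>T > 0\<close> by (intro mult_right_mono) auto
  moreover have "(N * T) * ((\<alpha> * T / 2) * (\<beta> * T / 2))
      = (N * (p * q) * T / 4) * ((1 - p) * (1 - q) * T\<^sup>2)"
    by (simp add: \<alpha>_def \<beta>_def power2_eq_square)
  moreover have "1 * ((1 - p) * (1 - q) * T\<^sup>2) < (N * (p * q) * T / 4) * ((1 - p) * (1 - q) * T\<^sup>2)"
    using b \<open>T > 0\<close> assms by (intro mult_strict_right_mono) auto
  moreover have "line_cubic p q N T = (1 + N * T) * ((\<alpha> * T - 1) * (\<beta> * T - 1)) - (1 - p) * (1 - q) * T\<^sup>2"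
    by (simp add: line_cubic_def \<alpha>_def \<beta>_def algebra_simps)
  ultimately have "line_cubic p q N T > 0" by linarith
  with T show ?thesis by blast
qed

lemma disc_factor_pos_negative_root:
  fixes p q N t :: real
  assumes "0 < p" "p < 1" "q < 1" "0 < 1 + N * t" "t < 0"
  shows "disc_factor p q N t > 0"
proof -
  have "p * (1 - q) * t < 0" using assms by (simp add: mult_pos_neg)
  then have "(1 + N * t) * (1 - p * (1 - q) * t) > 0" using assms by simp
  moreover have "(1 - p) * t < 0" using assms by (simp add: mult_pos_neg)
  ultimately show ?thesis by (simp add: disc_factor_def)
qed

text \<open>At a root, multiplying \<open>disc_factor\<close> by the remaining factor \<open>1 - q (1 - p) t\<close> of the product
  turns it into a multiple of \<open>(1 - p q) t - 1\<close>, because \<open>1 - q + q (1 - p) = 1 - p q\<close>.\<close>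

lemma disc_factor_pos_middle_root:
  fixes p q N t :: real
  assumes "p < 1" "0 < t" and "(1 - p * q) * t > 1" and "q * (1 - p) * t < 1"
    and "line_cubic p q N t = 0"
  shows "disc_factor p q N t > 0"
proof -
  have "disc_factor p q N t * (1 - q * (1 - p) * t)
      = line_cubic p q N t + (1 - p) * t * ((1 - p * q) * t - 1)"
    by (simp add: disc_factor_def line_cubic_def algebra_simps power2_eq_square)
  also have "\<dots> > 0" using assms by simp
  finally show ?thesis using assms(4) by (simp add: zero_less_mult_iff)
qed

lemma disc_factor_neg_large_root:
  fixes p q N t :: real
  assumes "p < 1" "0 < N" "0 < t" and "p * (1 - q) * t > 1"
  shows "disc_factor p q N t < 0"
proof -
  have "(1 + N * t) * (1 - p * (1 - q) * t) < 0" using assms by (intro mult_pos_neg) (auto simp: add_pos_pos)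
  moreover have "(1 - p) * t > 0" using assms by simp
  ultimately show ?thesis by (simp add: disc_factor_def)
qed

text \<open>The roots lie in \<open>(- 1 / N, 0)\<close>, in \<open>(s, 1 / m)\<close> and beyond \<open>1 / n\<close>, where \<open>s = 1 / (1 - p q)\<close> and
  \<open>m\<close>, \<open>n\<close> are the larger and the smaller of the two slopes; these locations determine the sign
  of \<open>disc_factor\<close> for both orders of \<open>p\<close> and \<open>q\<close>.\<close>

lemma line_cubic_roots:
  fixes p q N :: real
  assumes pq: "0 < p" "p < 1" "0 < q" "q < 1" and N: "0 < N"
  obtains r1 r2 r3 where
    "line_cubic p q N r1 = 0" "line_cubic p q N r2 = 0" "line_cubic p q N r3 = 0"
    "r1 < 0" "0 < r2" "r2 < r3"
    "disc_factor p q N r1 > 0" "disc_factor q p N r1 > 0"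
    "disc_factor p q N r2 > 0" "disc_factor q p N r2 > 0"
    "disc_factor p q N r3 < 0" "disc_factor q p N r3 < 0"
proof -
  define \<alpha> where "\<alpha> = p * (1 - q)"
  define \<beta> where "\<beta> = q * (1 - p)"
  define m where "m = max \<alpha> \<beta>"
  define n where "n = min \<alpha> \<beta>"
  define s where "s = 1 / (1 - p * q)"
  have ab: "\<alpha> > 0" "\<beta> > 0" using pq by (simp_all add: \<alpha>_def \<beta>_def)
  then have mn: "0 < n" "n \<le> m" "0 < m" "\<alpha> \<le> m" "\<beta> \<le> m" "n \<le> \<alpha>" "n \<le> \<beta>"
    by (auto simp: m_def n_def)
  have d: "1 - p * q > 0" using mult_less_one pq by simp
  have s0: "s > 0" using d by (simp add: s_def)
  have "\<alpha> < 1 - p * q" "\<beta> < 1 - p * q" using pq by (simp_all add: \<alpha>_def \<beta>_def algebra_simps)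
  then have "m < 1 - p * q" by (simp add: m_def)
  then have sm: "s < 1 / m" using mn d by (simp add: s_def frac_less2)
  have Fm: "line_cubic p q N (1 / m) < 0"
    using pq mn ab by (intro line_cubic_neg_at_zero_of_product) (auto simp: m_def max_def \<alpha>_def \<beta>_def)
  have Fn: "line_cubic p q N (1 / n) < 0"
    using pq mn ab by (intro line_cubic_neg_at_zero_of_product) (auto simp: n_def min_def \<alpha>_def \<beta>_def)
  have FN: "line_cubic p q N (- 1 / N) < 0"
    using pq N by (intro line_cubic_neg_at_zero_of_product) auto
  have F0: "line_cubic p q N 0 > 0" by (simp add: line_cubic_def)
  have Fs: "line_cubic p q N s > 0" unfolding s_def using line_cubic_pos_middle pq N by simp
  obtain T where T: "T \<ge> 1 / n" "line_cubic p q N T > 0"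
    using line_cubic_pos_far[OF pq N] by blast
  obtain r1 where r1: "- 1 / N \<le> r1" "r1 \<le> 0" "line_cubic p q N r1 = 0"
    using IVT'[of "line_cubic p q N" "- 1 / N" 0 0] FN F0 N continuous_on_line_cubic by auto
  have r1': "- 1 / N < r1" "r1 < 0" using r1 FN F0 by (force simp: less_le)+
  obtain r2 where r2: "s \<le> r2" "r2 \<le> 1 / m" "line_cubic p q N r2 = 0"
    using IVT2'[of "line_cubic p q N" "1 / m" 0 s] Fm Fs sm continuous_on_line_cubic by auto
  have r2': "s < r2" "r2 < 1 / m" using r2 Fm Fs by (force simp: less_le)+
  obtain r3 where r3: "1 / n \<le> r3" "r3 \<le> T" "line_cubic p q N r3 = 0"
    using IVT'[of "line_cubic p q N" "1 / n" 0 T] Fn T continuous_on_line_cubic by auto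
  have r3': "1 / n < r3" using r3 Fn by (force simp: less_le)
  have "1 / m \<le> 1 / n" using mn by (simp add: frac_le)
  then have r23: "r2 < r3" using r2' r3' by linarith
  have r20: "r2 > 0" using s0 r2' by linarith
  have N1: "0 < 1 + N * r1" using r1' N by (simp add: field_simps)
  have "m * r2 < 1" using r2' mn by (simp add: field_simps)
  moreover have "\<alpha> * r2 \<le> m * r2" "\<beta> * r2 \<le> m * r2" using mn r20 by simp_all
  ultimately have m2: "\<alpha> * r2 < 1" "\<beta> * r2 < 1" by linarith+
  have "n * r3 > 1" using r3' mn by (simp add: field_simps)
  moreover have "n * r3 \<le> \<alpha> * r3" "n * r3 \<le> \<beta> * r3" using mn r20 r23 by simp_all
  ultimately have m3: "\<alpha> * r3 > 1" "\<beta> * r3 > 1" by linarith+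
  have s2: "(1 - p * q) * r2 > 1" using r2' d by (simp add: s_def field_simps)
  show thesis
  proof (rule that[of r1 r2 r3])
    show "disc_factor p q N r1 > 0" "disc_factor q p N r1 > 0"
      using disc_factor_pos_negative_root pq N1 r1' by simp_all
    show "disc_factor p q N r2 > 0"
      using disc_factor_pos_middle_root pq r20 s2 m2 r2 by (simp add: \<beta>_def)
    show "disc_factor q p N r2 > 0"
      using disc_factor_pos_middle_root[of q r2 p N] pq r20 s2 m2 r2
      by (simp add: \<alpha>_def mult.commute line_cubic_commute[of q p])
    show "disc_factor p q N r3 < 0" "disc_factor q p N r3 < 0"
      using disc_factor_neg_large_root pq N r20 r23 m3 by (simp_all add: \<alpha>_def \<beta>_def)
  qed (use r1 r1' r2 r3 r20 r23 in auto)
qed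

text \<open>The difference of the two sides is a quadratic with three zeros; dividing differences of its
  values by differences of the zeros kills its coefficients one by one.\<close>

lemma cubic_factors:
  fixes c0 c1 c2 c3 x y z t :: "'a::idom"
  assumes F: "\<And>t. F t = c0 + c1 * t + c2 * t\<^sup>2 + c3 * t ^ 3"
    and roots: "F x = 0" "F y = 0" "F z = 0"
    and "x \<noteq> y" "x \<noteq> z" "y \<noteq> z"
  shows "F t = c3 * (t - x) * (t - y) * (t - z)"
proof -
  define d2 where "d2 = c2 + c3 * (x + y + z)"
  define d1 where "d1 = c1 - c3 * (x * y + x * z + y * z)"
  define d0 where "d0 = c0 + c3 * (x * y * z)"
  have G: "F t - c3 * (t - x) * (t - y) * (t - z) = d0 + d1 * t + d2 * t\<^sup>2" for t
    unfolding F d0_def d1_def d2_def by (simp add: algebra_simps power2_eq_square power3_eq_cube)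
  have g: "d0 + d1 * x + d2 * x\<^sup>2 = 0" "d0 + d1 * y + d2 * y\<^sup>2 = 0" "d0 + d1 * z + d2 * z\<^sup>2 = 0"
    using G[of x] G[of y] G[of z] roots by simp_all
  have "(x - y) * (d1 + d2 * (x + y)) = (d0 + d1 * x + d2 * x\<^sup>2) - (d0 + d1 * y + d2 * y\<^sup>2)"
    by (simp add: algebra_simps power2_eq_square)
  then have xy: "d1 + d2 * (x + y) = 0" using g \<open>x \<noteq> y\<close> by simp
  have "(x - z) * (d1 + d2 * (x + z)) = (d0 + d1 * x + d2 * x\<^sup>2) - (d0 + d1 * z + d2 * z\<^sup>2)"
    by (simp add: algebra_simps power2_eq_square)
  then have xz: "d1 + d2 * (x + z) = 0" using g \<open>x \<noteq> z\<close> by simp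
  have "d2 * (y - z) = (d1 + d2 * (x + y)) - (d1 + d2 * (x + z))" by (simp add: algebra_simps)
  then have "d2 = 0" using xy xz \<open>y \<noteq> z\<close> by simp
  with xy g have "d1 = 0" "d0 = 0" by simp_all
  with \<open>d2 = 0\<close> G[of t] show ?thesis by simp
qed

lemma line_cubic_factors:
  fixes p q N x y z t :: "'a::idom"
  assumes "line_cubic p q N x = 0" "line_cubic p q N y = 0" "line_cubic p q N z = 0"
    and "x \<noteq> y" "x \<noteq> z" "y \<noteq> z"
  shows "line_cubic p q N t = p * (1 - p) * q * (1 - q) * N * (t - x) * (t - y) * (t - z)"
proof (rule cubic_factors[where F = "line_cubic p q N" and ?c0.0 = 1
      and ?c1.0 = "N - p * (1 - q) - q * (1 - p)"
      and ?c2.0 = "p * (1 - q) * (q * (1 - p)) - N * (p * (1 - q) + q * (1 - p)) - (1 - p) * (1 - q)"])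
  show "line_cubic p q N t = 1 + (N - p * (1 - q) - q * (1 - p)) * t
      + (p * (1 - q) * (q * (1 - p)) - N * (p * (1 - q) + q * (1 - p)) - (1 - p) * (1 - q)) * t\<^sup>2
      + p * (1 - p) * q * (1 - q) * N * t ^ 3" for t
    by (simp add: line_cubic_def algebra_simps power2_eq_square power3_eq_cube)
qed fact+

section \<open>The two equations on the line\<close>

definition line_point :: "complex \<Rightarrow> complex \<Rightarrow> complex \<Rightarrow> complex" where
  "line_point a b t = b + a * (1 - cnj a * b) * (1 - b * cnj b) * t"

definition solution_cubic :: "complex \<Rightarrow> complex \<Rightarrow> complex \<Rightarrow> complex" where
  "solution_cubic a b = line_cubic (a * cnj a) (b * cnj b) ((1 - cnj a * b) * (1 - a * cnj b))"

text \<open>The second equation after substituting \<open>w = Phi2 a b z / (a * Phi2_star a b z)\<close> and clearing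
  all denominators: a quintic in \<open>z\<close>.\<close>

definition eliminant :: "complex \<Rightarrow> complex \<Rightarrow> complex \<Rightarrow> complex" where
  "eliminant a b z =
     (Phi2 a b z - a * a * Phi2_star a b z) * (Phi2 a b z - b * a * Phi2_star a b z)
     - z * b * (a * Phi2_star a b z - cnj a * Phi2 a b z) * (a * Phi2_star a b z - cnj b * Phi2 a b z)"

lemma solution_cubic_commute: "solution_cubic a b = solution_cubic b a"
  by (rule ext) (simp add: solution_cubic_def line_cubic_commute[of "a * cnj a"] mult.commute)

lemma Phi2_commute: "Phi2 a b = Phi2 b a" "Phi2_star a b = Phi2_star b a"
  by (auto simp: Phi2_def Phi2_star_def)

lemma one_minus_cnj_mult_nonzero:
  assumes "norm x < 1" "norm y < 1"
  shows "1 - cnj x * y \<noteq> 0"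
proof
  assume "1 - cnj x * y = 0"
  then have "norm (cnj x * y) = 1" by (simp add: algebra_simps)
  moreover have "norm x * norm y \<le> norm x * 1" using assms by (intro mult_left_mono) auto
  ultimately show False using assms by (simp add: norm_mult)
qed

text \<open>The algebraic identities are stated with \<open>a'\<close>, \<open>b'\<close> in place of the conjugates: they hold as
  polynomial identities in five independent variables.\<close>

lemma line_identity:
  fixes a a' b b' t :: "'a::idom"
  shows "(a + b * (1 - b' * a) * (1 - a * a') * t) * (1 - a * a' * (1 - b * b') * t) * (1 - a * b' * (1 - a' * b) * t)
     - t * (b + a * (1 - a' * b) * (1 - b * b') * t - a)
   = a * line_cubic (a * a') (b * b') ((1 - a' * b) * (1 - a * b')) t"
  unfolding line_cubic_def by algebra

lemma Phi2_line_point: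
  "Phi2 a b (line_point a b t) =
     a * (1 - cnj a * b) * (1 - b * cnj b) * (t * (line_point a b t - a))"
  by (simp add: Phi2_def line_point_def)

lemma Phi2_star_line_point:
  "Phi2_star a b (line_point a b t) = (1 - cnj a * b) * (1 - b * cnj b) *
     ((1 - a * cnj a * (1 - b * cnj b) * t) * (1 - a * cnj b * (1 - cnj a * b) * t))"
proof -
  have "1 - cnj a * line_point a b t = (1 - cnj a * b) * (1 - a * cnj a * (1 - b * cnj b) * t)"
    "1 - cnj b * line_point a b t = (1 - b * cnj b) * (1 - a * cnj b * (1 - cnj a * b) * t)"
    by (simp_all add: line_point_def algebra_simps)
  then show ?thesis by (simp add: Phi2_star_def)
qed

text \<open>The right-hand side contains, besides a constant, only a cubic symmetric in \<open>a\<close> and \<open>b\<close>.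
  Exchanging \<open>a\<close> and \<open>b\<close> exchanges the two coordinates of the line and the two equations, so
  this one computation handles both equations at once.\<close>

lemma first_equation_on_line:
  "a * line_point b a t * Phi2_star a b (line_point a b t) - Phi2 a b (line_point a b t)
   = a * a * (1 - cnj a * b) * (1 - b * cnj b) * solution_cubic a b t"
proof -
  define k where "k = (1 - cnj a * b) * (1 - b * cnj b)"
  define v where "v = (1 - a * cnj a * (1 - b * cnj b) * t) * (1 - a * cnj b * (1 - cnj a * b) * t)"
  have *: "line_point b a t * v - t * (line_point a b t - a) = a * solution_cubic a b t"
    using line_identity[of a b "cnj b" "cnj a" t]
    by (simp add: line_point_def solution_cubic_def v_def mult.assoc)
  have "a * line_point b a t * Phi2_star a b (line_point a b t) - Phi2 a b (line_point a b t)
      = a * k * (line_point b a t * v - t * (line_point a b t - a))"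
    unfolding Phi2_line_point Phi2_star_line_point k_def[symmetric] v_def[symmetric]
    by (simp only: mult.assoc[of a "1 - cnj a * b"] k_def[symmetric]) (simp add: algebra_simps)
  also have "\<dots> = a * k * (a * solution_cubic a b t)" by (simp only: *)
  finally show ?thesis by (simp add: k_def)
qed

text \<open>Here \<open>u\<close> and \<open>v\<close> are \<open>Phi2\<close> and \<open>Phi2_star\<close> on the line, with constant factors divided
  out.\<close>

lemma eliminant_identity:
  fixes a a' b b' t z u v :: "'a::idom"
  assumes z: "z = b + a * (1 - a' * b) * (1 - b * b') * t"
    and u: "u = t * (z - a)"
    and v: "v = (1 - a * a' * (1 - b * b') * t) * (1 - a * b' * (1 - a' * b) * t)"
  shows "(u - a * v) * (u - b * v) - z * b * (v - a' * u) * (v - b' * u) =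
     - (z * (z - a) * line_cubic (a * a') (b * b') ((1 - a' * b) * (1 - a * b')) t)"
  unfolding line_cubic_def u v z by algebra

text \<open>Every \<open>z\<close> is a \<open>line_point\<close> when \<open>a\<close> and the other two factors in its slope are nonzero, so
  this is a factorization of the full quintic. The factors \<open>z\<close> and \<open>z - a\<close> belong to the two
  solutions \<open>(0, b)\<close> and \<open>(a, 0)\<close>.\<close>

lemma eliminant_on_line:
  "eliminant a b (line_point a b t) = - ((a * (1 - cnj a * b) * (1 - b * cnj b))\<^sup>2) *
     (line_point a b t * (line_point a b t - a) * solution_cubic a b t)"
proof -
  define u where "u = t * (line_point a b t - a)"
  define v where "v = (1 - a * cnj a * (1 - b * cnj b) * t) * (1 - a * cnj b * (1 - cnj a * b) * t)"
  have *: "(u - a * v) * (u - b * v) - line_point a b t * b * (v - cnj a * u) * (v - cnj b * u) =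
     - (line_point a b t * (line_point a b t - a) * solution_cubic a b t)"
    unfolding solution_cubic_def
    by (rule eliminant_identity) (simp_all add: line_point_def u_def v_def)
  have "eliminant a b (line_point a b t) = (a * (1 - cnj a * b) * (1 - b * cnj b))\<^sup>2 *
     ((u - a * v) * (u - b * v) - line_point a b t * b * (v - cnj a * u) * (v - cnj b * u))"
    unfolding eliminant_def Phi2_line_point Phi2_star_line_point u_def[symmetric] v_def[symmetric]
    by algebra
  then show ?thesis unfolding * by simp
qed

lemma one_minus_norm_sq_line_point:
  "1 - line_point a b (of_real t) * cnj (line_point a b (of_real t)) = (1 - b * cnj b) *
     disc_factor (a * cnj a) (b * cnj b) ((1 - cnj a * b) * (1 - a * cnj b)) (of_real t)"
  unfolding line_point_def disc_factor_def complex_cnj_add complex_cnj_mult complex_cnj_diff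
    complex_cnj_one complex_cnj_cnj complex_cnj_complex_of_real
  by algebra

lemma Phi2_star_nonzero_at_zero_of_Phi2:
  assumes "norm a < 1" "norm b < 1" "Phi2 a b z = 0"
  shows "Phi2_star a b z \<noteq> 0"
  using assms one_minus_cnj_mult_nonzero by (auto simp: Phi2_def Phi2_star_def)

text \<open>A root of the cubic satisfies the equations without denominators. If a denominator vanished,
  so would the numerator, but the zeros of \<open>Phi2\<close> lie inside the disc and those of
  \<open>Phi2_star\<close> outside.\<close>

lemma line_point_in_solutions:
  assumes "norm a < 1" "norm b < 1" "solution_cubic a b t = 0"
  shows "(line_point a b t, line_point b a t) \<in> solutions a b"
proof -
  let ?z = "line_point a b t" and ?w = "line_point b a t"
  have 1: "Phi2 a b ?z = a * ?w * Phi2_star a b ?z"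
    using first_equation_on_line[of a b t] assms by simp
  have 2: "Phi2 a b ?w = b * ?z * Phi2_star a b ?w"
    using first_equation_on_line[of b a t] assms
    by (simp add: Phi2_commute[of b a] solution_cubic_commute[of b a])
  have "Phi2_star a b ?z \<noteq> 0" "Phi2_star a b ?w \<noteq> 0"
    using 1 2 Phi2_star_nonzero_at_zero_of_Phi2 assms by fastforce+
  with 1 2 show ?thesis by (simp add: solutions_def)
qed

section \<open>Elimination and multiplicities\<close>

text \<open>The numerator of \<open>Phi2_star\<close> on the graph of the first equation (\<open>Phi2_star_graph\<close>), hence
  nonzero at every solution.\<close>

definition graph_denominator :: "complex \<Rightarrow> complex \<Rightarrow> complex \<Rightarrow> complex" where
  "graph_denominator a b z =
     (a * Phi2_star a b z - cnj a * Phi2 a b z) * (a * Phi2_star a b z - cnj b * Phi2 a b z)"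

lemma Phi2_star_graph:
  assumes "a \<noteq> 0" "Phi2_star a b z \<noteq> 0"
  shows "Phi2_star a b (Phi2 a b z / (a * Phi2_star a b z)) =
    graph_denominator a b z / (a * Phi2_star a b z)\<^sup>2"
proof -
  have "(1 - c * (x / y)) * (1 - d * (x / y)) = (y - c * x) * (y - d * x) / y\<^sup>2"
    if "y \<noteq> 0" for c d x y :: complex
    using that by (simp add: field_simps power2_eq_square)
  from this[of "a * Phi2_star a b z"] show ?thesis
    using assms unfolding Phi2_star_def[of a b "_ / _"] graph_denominator_def by simp
qed

lemma second_equation_on_graph:
  assumes "a \<noteq> 0" "Phi2_star a b z \<noteq> 0" "graph_denominator a b z \<noteq> 0"
  defines "w \<equiv> Phi2 a b z / (a * Phi2_star a b z)"
  shows "Phi2 a b w / Phi2_star a b w - z * b = eliminant a b z / graph_denominator a b z"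
proof -
  define y where "y = a * Phi2_star a b z"
  have y: "y \<noteq> 0" using assms by (simp add: y_def)
  have "Phi2 a b w = (Phi2 a b z - a * y) * (Phi2 a b z - b * y) / y\<^sup>2"
    using y unfolding w_def y_def[symmetric] Phi2_def[of a b "_ / _"]
    by (simp add: field_simps power2_eq_square)
  moreover have "Phi2_star a b w = graph_denominator a b z / y\<^sup>2"
    using Phi2_star_graph assms by (simp add: y_def)
  ultimately have "Phi2 a b w / Phi2_star a b w - z * b =
      ((Phi2 a b z - a * y) * (Phi2 a b z - b * y) - z * b * graph_denominator a b z)
        / graph_denominator a b z"
    using y assms(3) by (simp add: diff_divide_distrib)
  also have "(Phi2 a b z - a * y) * (Phi2 a b z - b * y) - z * b * graph_denominator a b z = eliminant a b z"
    by (simp add: eliminant_def graph_denominator_def y_def mult.assoc)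
  finally show ?thesis .
qed

lemma solutions_eliminant:
  assumes "a \<noteq> 0" "(z, w) \<in> solutions a b"
  shows "w = Phi2 a b z / (a * Phi2_star a b z)" "Phi2_star a b z \<noteq> 0"
    "graph_denominator a b z \<noteq> 0" "eliminant a b z = 0"
proof -
  show w: "w = Phi2 a b z / (a * Phi2_star a b z)" and z: "Phi2_star a b z \<noteq> 0"
    using assms by (auto simp: solutions_def field_simps)
  show d: "graph_denominator a b z \<noteq> 0"
    using Phi2_star_graph[OF assms(1) z] assms(2) unfolding w[symmetric] by (auto simp: solutions_def)
  show "eliminant a b z = 0"
    using second_equation_on_graph[OF assms(1) z d] assms(2) d unfolding w[symmetric]
    by (simp add: solutions_def)
qed

lemma count_image_mset_inj:
  assumes "inj f"
  shows "count (image_mset f M) (f x) = count M x"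
  by (induction M) (use assms in \<open>auto simp: inj_eq\<close>)

text \<open>Collects the factors that vanish at \<open>x\<close>; the remaining product is nonzero there, which is the
  form needed for the order of vanishing.\<close>

lemma prod_mset_diff_split:
  fixes t x :: "'a::comm_ring_1"
  shows "(\<Prod>y\<in>#M. t - y) = (\<Prod>y\<in>#filter_mset (\<lambda>y. y \<noteq> x) M. t - y) * (t - x) ^ count M x"
  by (induction M) (auto simp: mult_ac)

lemma holomorphic_on_prod_mset_diff: "(\<lambda>t. \<Prod>y\<in>#M. t - y) holomorphic_on S"
  by (induction M) (auto intro!: holomorphic_intros)

lemma zorder_prod_mset_over_nonzero:
  fixes f D :: "complex \<Rightarrow> complex"
  assumes "open S" "x \<in> S" "D holomorphic_on S" "\<And>t. t \<in> S \<Longrightarrow> D t \<noteq> 0" "c \<noteq> 0"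
    and "\<And>t. t \<in> S \<Longrightarrow> f t = c * (\<Prod>y\<in>#M. t - y) / D t"
  shows "zorder f x = int (count M x)"
proof (rule zorder_eqI[OF assms(1,2)])
  let ?g = "\<lambda>t. c * (\<Prod>y\<in>#filter_mset (\<lambda>y. y \<noteq> x) M. t - y) / D t"
  show "?g holomorphic_on S"
    using assms by (intro holomorphic_intros holomorphic_on_prod_mset_diff) auto
  show "?g x \<noteq> 0" using assms by (auto simp: prod_mset_zero_iff)
  show "f t = ?g t * (t - x) powi int (count M x)" if "t \<in> S" for t
    using assms(6)[OF that] prod_mset_diff_split[of t M x] by simp
qed

lemma solution_mult_eq_count:
  assumes "a \<noteq> 0" "(z, w) \<in> solutions a b" "K \<noteq> 0"
    and E: "\<And>t. eliminant a b t = K * (\<Prod>y\<in>#M. t - y)"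
  shows "solution_mult a b (z, w) = int (count M z)"
proof -
  define S where "S = {t. Phi2_star a b t * graph_denominator a b t \<noteq> 0}"
  have hol: "Phi2_star a b holomorphic_on T" "graph_denominator a b holomorphic_on T" for T
    unfolding graph_denominator_def[abs_def] Phi2_star_def[abs_def] Phi2_def
    by (intro holomorphic_intros)+
  have "open S"
    unfolding S_def
    by (intro open_Collect_neq holomorphic_on_imp_continuous_on holomorphic_intros hol)
  have inS: "Phi2_star a b t \<noteq> 0" "graph_denominator a b t \<noteq> 0" if "t \<in> S" for t
    using that by (auto simp: S_def)
  have "z \<in> S" using solutions_eliminant[OF assms(1,2)] by (simp add: S_def)
  show ?thesis
    unfolding solution_mult_def Let_def fst_conv
  proof (rule zorder_prod_mset_over_nonzero[where c = K and D = "graph_denominator a b"])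
    show "open S" "z \<in> S" "K \<noteq> 0" by fact+
    show "graph_denominator a b holomorphic_on S" by (rule hol)
    show "graph_denominator a b t \<noteq> 0" if "t \<in> S" for t using inS that by simp
    show "Phi2 a b (Phi2 a b t / (a * Phi2_star a b t)) / Phi2_star a b (Phi2 a b t / (a * Phi2_star a b t)) - t * b
        = K * (\<Prod>y\<in>#M. t - y) / graph_denominator a b t" if "t \<in> S" for t
      using second_equation_on_graph[OF assms(1) inS[OF that]] by (simp add: E)
  qed
qed

section \<open>The solutions of the system\<close>

lemma card_insert2_eq_5_iff:
  assumes "x \<noteq> y" "distinct [u, v, w]"
  shows "card {x, y, u, v, w} = 5 \<longleftrightarrow> count {#x, y, u, v, w#} x = 1 \<and> count {#x, y, u, v, w#} y = 1"
  using assms by (auto simp: card_insert_if)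

lemma collinear_affine_image_of_real:
  fixes b c :: complex
  shows "collinear ((\<lambda>r. b + c * of_real r) ` R)"
  unfolding collinear_def
proof (rule exI[of _ c], intro ballI)
  fix x y assume "x \<in> (\<lambda>r. b + c * of_real r) ` R" "y \<in> (\<lambda>r. b + c * of_real r) ` R"
  then obtain r s where "x = b + c * of_real r" "y = b + c * of_real s" by blast
  then have "x - y = (r - s) *\<^sub>R c" by (simp add: scaleR_conv_of_real algebra_simps)
  then show "\<exists>d. x - y = d *\<^sub>R c" ..
qed

theorem theorem17:
  fixes f1 f2 :: complex
  assumes "f1 \<in> ball 0 1" and "f2 \<in> ball 0 1" and "f1 * f2 \<noteq> 0"
  shows "\<exists>(z :: nat \<Rightarrow> complex) (w :: nat \<Rightarrow> complex).
    solutions f1 f2 = {(0, f2), (f1, 0), (z 1, w 1), (z 2, w 2), (z 3, w 3)} \<and>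
    (\<forall>p \<in> solutions f1 f2. solution_mult f1 f2 p =
       int (count {#(0, f2), (f1, 0), (z 1, w 1), (z 2, w 2), (z 3, w 3)#} p)) \<and>
    (card (solutions f1 f2) = 5 \<longleftrightarrow>
       solution_mult f1 f2 (0, f2) = 1 \<and> solution_mult f1 f2 (f1, 0) = 1) \<and>
    distinct [(z 1, w 1), (z 2, w 2), (z 3, w 3)] \<and>
    solutions f1 f2 \<inter> (ball 0 1 \<times> ball 0 1) = {(0, f2), (f1, 0), (z 1, w 1), (z 2, w 2)} \<and>
    solutions f1 f2 \<inter> {(a, b). norm a > 1 \<and> norm b > 1} = {(z 3, w 3)} \<and>
    collinear {z 1, z 2, z 3} \<and> collinear {w 1, w 2, w 3} \<and>
    (\<forall>i \<in> {1, 2, 3}. w i \<noteq> f1 \<and>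
       (z i - f2) / (w i - f1) = f1 * Phi2_star f1 f2 f2 / (f2 * Phi2_star f1 f2 f1)) \<and>
    collinear {f1, w 1, w 2, w 3} \<and>
    (\<forall>i \<in> {1, 2, 3}. \<forall>j \<in> {1, 2, 3}. i \<noteq> j \<longrightarrow>
       w j \<noteq> f1 \<and> (w i - f1) / (w j - f1) \<in> \<real>) \<and>
    collinear {f2, z 1, z 2, z 3} \<and>
    (\<forall>i \<in> {1, 2, 3}. \<forall>j \<in> {1, 2, 3}. i \<noteq> j \<longrightarrow>
       z j \<noteq> f2 \<and> (z i - f2) / (z j - f2) \<in> \<real>)"
proof -
  define p where "p = (norm f1)\<^sup>2"
  define q where "q = (norm f2)\<^sup>2"
  define N where "N = (norm (1 - cnj f1 * f2))\<^sup>2"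
  have nf: "norm f1 < 1" "norm f2 < 1" and f0: "f1 \<noteq> 0" "f2 \<noteq> 0" using assms by auto
  have C: "1 - cnj f1 * f2 \<noteq> 0" "1 - cnj f2 * f1 \<noteq> 0"
    and AB: "1 - f1 * cnj f1 \<noteq> 0" "1 - f2 * cnj f2 \<noteq> 0"
    using one_minus_cnj_mult_nonzero nf by (auto simp: mult.commute)
  have pq: "0 < p" "p < 1" "0 < q" "q < 1" and N: "0 < N"
    using nf f0 C by (auto simp: p_def q_def N_def power_less_one_iff abs_square_less_1)
  have cx: "f1 * cnj f1 = of_real p" "f2 * cnj f2 = of_real q"
    "(1 - cnj f1 * f2) * (1 - f1 * cnj f2) = of_real N"
    "(1 - cnj f2 * f1) * (1 - f2 * cnj f1) = of_real N"
    unfolding p_def q_def N_def complex_norm_square by (simp_all add: mult.commute)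
  obtain r1 r2 r3 where roots:
    "line_cubic p q N r1 = 0" "line_cubic p q N r2 = 0" "line_cubic p q N r3 = 0"
    and r: "r1 < 0" "0 < r2" "r2 < r3"
    and inside: "disc_factor p q N r1 > 0" "disc_factor q p N r1 > 0"
    "disc_factor p q N r2 > 0" "disc_factor q p N r2 > 0"
    and outside: "disc_factor p q N r3 < 0" "disc_factor q p N r3 < 0"
    using line_cubic_roots[OF pq N] by metis
  define \<tau> where "\<tau> i = (if i = 1 then r1 else if i = 2 then r2 else r3)" for i :: nat
  have \<tau>: "\<tau> 1 = r1" "\<tau> 2 = r2" "\<tau> 3 = r3" and \<tau>0: "\<tau> i \<noteq> 0" for i
    using r by (auto simp: \<tau>_def)
  define z where "z i = line_point f1 f2 (of_real (\<tau> i))" for i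
  define w where "w i = line_point f2 f1 (of_real (\<tau> i))" for i
  define c where "c = f1 * (1 - cnj f1 * f2) * (1 - f2 * cnj f2)"
  define d where "d = f2 * (1 - cnj f2 * f1) * (1 - f1 * cnj f1)"
  have cd0: "c \<noteq> 0" "d \<noteq> 0" using f0 C AB by (simp_all add: c_def d_def)
  have zc: "z i = f2 + c * of_real (\<tau> i)" and wd: "w i = f1 + d * of_real (\<tau> i)" for i
    by (simp_all add: z_def w_def c_def d_def line_point_def)
  have cubic: "solution_cubic f1 f2 (of_real t) = of_real (line_cubic p q N t)" for t
    by (simp add: solution_cubic_def cx line_cubic_of_real)

  have sol: "(z i, w i) \<in> solutions f1 f2" for i
    unfolding z_def w_def using roots nf
    by (intro line_point_in_solutions) (auto simp: cubic \<tau>_def)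
  have sol0: "(0, f2) \<in> solutions f1 f2" "(f1, 0) \<in> solutions f1 f2"
    using Phi2_star_nonzero_at_zero_of_Phi2[OF nf, of f1] Phi2_star_nonzero_at_zero_of_Phi2[OF nf, of f2]
    by (auto simp: solutions_def Phi2_def Phi2_star_def)

  \<comment> \<open>\<open>M\<close> lists the roots of the quintic with multiplicity; \<open>0\<close> or \<open>f1\<close> may coincide with a \<open>z i\<close>.\<close>
  define M where "M = {#0, f1, z 1, z 2, z 3#}"
  define K where "K = - (of_real (p * (1 - p) * q * (1 - q) * N) / c)"
  have K0: "K \<noteq> 0" using pq N cd0 by (simp add: K_def)
  have E: "eliminant f1 f2 t = K * (\<Prod>y\<in>#M. t - y)" for t
  proof -
    define s where "s = (t - f2) / c"
    have t: "t = f2 + c * s" using cd0 by (simp add: s_def)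
    then have "t = line_point f1 f2 s" by (simp add: line_point_def c_def)
    then have "eliminant f1 f2 t = - (c\<^sup>2) * (t * (t - f1) * solution_cubic f1 f2 s)"
      using eliminant_on_line[of f1 f2 s] by (simp add: c_def)
    also have "solution_cubic f1 f2 s =
        of_real p * (1 - of_real p) * of_real q * (1 - of_real q) * of_real N *
          (s - of_real r1) * (s - of_real r2) * (s - of_real r3)"
      unfolding solution_cubic_def cx
      using roots r by (intro line_cubic_factors) (auto simp: line_cubic_of_real)
    also have "- (c\<^sup>2) * (t * (t - f1) * \<dots>) =
        K * (t * (t - f1) * (c * (s - of_real r1)) * (c * (s - of_real r2)) * (c * (s - of_real r3)))"
      using cd0 by (simp add: K_def field_simps power2_eq_square)
    also have "\<dots> = K * (t * (t - f1) * (t - z 1) * (t - z 2) * (t - z 3))"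
    proof -
      have "c * (s - of_real r1) = t - z 1" "c * (s - of_real r2) = t - z 2"
        "c * (s - of_real r3) = t - z 3"
        by (simp_all add: zc \<tau> t algebra_simps del: One_nat_def)
      then show ?thesis by (simp only:)
    qed
    finally show ?thesis by (simp add: M_def mult.assoc)
  qed
  \<comment> \<open>By the first equation, solutions are determined by their first coordinate, so pairs can be
      counted by counting roots of the quintic.\<close>
  define g where "g t = (t, Phi2 f1 f2 t / (f1 * Phi2_star f1 f2 t))" for t
  have graph: "s = g (fst s)" if "s \<in> solutions f1 f2" for s
    using solutions_eliminant(1)[OF f0(1), of "fst s" "snd s"] that by (simp add: g_def prod_eq_iff)
  define P where "P = {#(0, f2), (f1, 0), (z 1, w 1), (z 2, w 2), (z 3, w 3)#}"
  have P: "P = image_mset g M"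
    using graph[OF sol0(1)] graph[OF sol0(2)] graph[OF sol] by (simp add: P_def M_def)
  have "inj g" by (auto simp: g_def inj_def)
  have setP: "set_mset P = {(0, f2), (f1, 0), (z 1, w 1), (z 2, w 2), (z 3, w 3)}"
    by (simp add: P_def)
  have S: "solutions f1 f2 = set_mset P"
  proof (rule set_eqI)
    fix s
    have "s \<in># P" if "s \<in> solutions f1 f2"
    proof -
      have "eliminant f1 f2 (fst s) = 0"
        using solutions_eliminant(4)[OF f0(1), of "fst s" "snd s"] that by simp
      then have "fst s \<in># M" using E K0 by (auto simp: prod_mset_zero_iff)
      then show ?thesis using graph[OF that] by (metis P image_eqI set_image_mset)
    qed
    then show "s \<in> solutions f1 f2 \<longleftrightarrow> s \<in># P" using sol sol0 setP by auto
  qed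
  have mult: "solution_mult f1 f2 s = int (count P s)" if "s \<in> solutions f1 f2" for s
  proof -
    have "solution_mult f1 f2 s = int (count M (fst s))"
      using solution_mult_eq_count[OF f0(1) _ K0 E, of "fst s" "snd s"] that by simp
    also have "count M (fst s) = count P (g (fst s))"
      unfolding P using count_image_mset_inj[OF \<open>inj g\<close>] by simp
    finally show ?thesis using graph[OF that] by simp
  qed

  have inj: "z i \<noteq> z j \<and> w i \<noteq> w j" if "\<tau> i \<noteq> \<tau> j" for i j
    using that cd0 by (simp add: zc wd)
  have \<tau>inj: "\<tau> 1 \<noteq> \<tau> 2" "\<tau> 1 \<noteq> \<tau> 3" "\<tau> 2 \<noteq> \<tau> 3" using r by (simp_all add: \<tau>_def)
  have dist: "distinct [(z 1, w 1), (z 2, w 2), (z 3, w 3)]"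
    using inj \<tau>inj by simp
  \<comment> \<open>The only possible coincidences are between a point on the line and one of the two
      explicit solutions.\<close>
  have "card (set_mset P) = 5 \<longleftrightarrow> count P (0, f2) = 1 \<and> count P (f1, 0) = 1"
    unfolding setP unfolding P_def by (rule card_insert2_eq_5_iff[OF _ dist]) (use f0 in simp)
  then have card: "card (solutions f1 f2) = 5 \<longleftrightarrow>
       solution_mult f1 f2 (0, f2) = 1 \<and> solution_mult f1 f2 (f1, 0) = 1"
    using mult sol0 by (simp add: S)

  have nz: "1 - (norm (z i))\<^sup>2 = (1 - q) * disc_factor p q N (\<tau> i)" for i
  proof -
    have "of_real (1 - (norm (z i))\<^sup>2) = 1 - z i * cnj (z i)"
      by (simp only: of_real_diff of_real_1 complex_norm_square)
    also have "\<dots> = of_real ((1 - q) * disc_factor p q N (\<tau> i))"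
      unfolding z_def one_minus_norm_sq_line_point cx disc_factor_of_real by simp
    finally have "of_real (1 - (norm (z i))\<^sup>2) = (of_real ((1 - q) * disc_factor p q N (\<tau> i)) :: complex)" .
    then show ?thesis by (simp only: of_real_eq_iff)
  qed
  have nw: "1 - (norm (w i))\<^sup>2 = (1 - p) * disc_factor q p N (\<tau> i)" for i
  proof -
    have "of_real (1 - (norm (w i))\<^sup>2) = 1 - w i * cnj (w i)"
      by (simp only: of_real_diff of_real_1 complex_norm_square)
    also have "\<dots> = of_real ((1 - p) * disc_factor q p N (\<tau> i))"
      unfolding w_def one_minus_norm_sq_line_point cx disc_factor_of_real by simp
    finally have "of_real (1 - (norm (w i))\<^sup>2) = (of_real ((1 - p) * disc_factor q p N (\<tau> i)) :: complex)" .
    then show ?thesis by (simp only: of_real_eq_iff)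
  qed
  have sq: "norm x < 1 \<longleftrightarrow> 0 < 1 - (norm x)\<^sup>2" "norm x > 1 \<longleftrightarrow> 1 - (norm x)\<^sup>2 < 0" for x :: complex
    using power_le_one_iff[of "norm x" 2] power_less_one_iff[of "norm x" 2] by auto
  have disc: "norm (z 1) < 1" "norm (w 1) < 1" "norm (z 2) < 1" "norm (w 2) < 1"
    and far: "norm (z 3) > 1" "norm (w 3) > 1"
    unfolding sq nz nw \<tau> using inside outside pq by (simp_all add: mult_pos_neg)

  have quotient: "(z i - f2) / (w i - f1) = f1 * Phi2_star f1 f2 f2 / (f2 * Phi2_star f1 f2 f1)" for i
    using \<tau>0 by (simp add: zc wd c_def d_def Phi2_star_def mult_ac)
  have ne: "z i \<noteq> f2" "w i \<noteq> f1" for i using \<tau>0 cd0 by (simp_all add: zc wd)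
  have real: "(w i - f1) / (w j - f1) \<in> \<real>" "(z i - f2) / (z j - f2) \<in> \<real>" for i j
    using cd0 by (simp_all add: zc wd flip: of_real_divide)
  have colz: "collinear {f2, z 1, z 2, z 3}" and colw: "collinear {f1, w 1, w 2, w 3}"
    using collinear_affine_image_of_real[of f2 c "{0, \<tau> 1, \<tau> 2, \<tau> 3}"]
      collinear_affine_image_of_real[of f1 d "{0, \<tau> 1, \<tau> 2, \<tau> 3}"]
    by (simp_all only: image_insert image_empty of_real_0 mult_zero_right add_0_right
        zc[symmetric] wd[symmetric])
  have colz': "collinear {z 1, z 2, z 3}" and colw': "collinear {w 1, w 2, w 3}"
    using collinear_subset[OF colz] collinear_subset[OF colw] by blast+
  show ?thesis
  proof (rule exI[of _ z], rule exI[of _ w], intro conjI ballI impI)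
    show "solutions f1 f2 = {(0, f2), (f1, 0), (z 1, w 1), (z 2, w 2), (z 3, w 3)}"
      by (simp add: S setP)
    show "solution_mult f1 f2 s =
        int (count {#(0, f2), (f1, 0), (z 1, w 1), (z 2, w 2), (z 3, w 3)#} s)"
      if "s \<in> solutions f1 f2" for s
      using mult[OF that] by (simp add: P_def)
    show "solutions f1 f2 \<inter> ball 0 1 \<times> ball 0 1 = {(0, f2), (f1, 0), (z 1, w 1), (z 2, w 2)}"
      using nf disc far by (auto simp: S setP)
    show "solutions f1 f2 \<inter> {(a, b). 1 < norm a \<and> 1 < norm b} = {(z 3, w 3)}"
      using nf disc far by (auto simp: S setP)
  qed (rule card dist colz colw colz' colw' quotient ne real)+
qed

end
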